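(* Let $\bm{M},\bm{D},\bm{K}\in\mathbb{R}^{n\times n}$, $\bm{B}\in\mathbb{R}^{n\times p_i}$, $\bm{C}\in\mathbb{R}^{p_o\times n}$, and let $s_0=ik_0$ with $k_0>0$ be an expansion point such that $\tilde{\bm{K}}=s_0^2\bm{M}+s_0\bm{D}+\bm{K}$ is invertible. Let $s\in\mathbb{C}$ be sufficiently close to $s_0$ that the full order transfer function $\bm{G}(s)$ is well-defined (the inverse in its definition exists). Let $r\ge 1$, and let $\bm{G}_r$ and $\bm{G}_{r+1}$ be the transfer functions of the reduced order models obtained after $r$ and $r+1$ iterations, respectively, of a second order Krylov subspace-based (moment-matching) model order reduction method about $s_0$ (as defined in the context). Suppose that $\bm{G}_r(s)$ and $\bm{G}_{r+1}(s)$ are well-defined (the inverses in their definitions exist) for $s$ sufficiently close to $s_0$, including $s=s_0$. Suppose moreover that $\bm{G}(s_0)\neq 0$ and $\bm{G}_q(s_0)\neq0$ for $q=r$ and $q=r+1$. Let $\|\cdot\|$ be a norm on $\mathbb{C}^{p_o\times p_i}$ and define $$E_r(s)=\frac{\|\bm{G}(s)-\bm{G}_r(s)\|}{\|\bm{G}(s)\|},\qquad \hat{E}_r(s)=\frac{\|\bm{G}_{r+1}(s)-\bm{G}_r(s)\|}{\|\bm{G}_r(s)\|},\qquad \tilde{E}_r(s)=\frac{\|\bm{G}_{r+1}(s)-\bm{G}_r(s)\|}{\|\bm{G}_{r+1}(s)\|}.$$ Then both $\hat{E}_r$ and $\tilde{E}_r$ are estimators for the true relative approximation error $E_r$ in the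 sense that, as $s\to s_0$, $$E_r(s)=\hat{E}_r(s)+\mathcal{O}\big((s-s_0)^{r+1}\big)\qquad\text{and}\qquad E_r(s)=\tilde{E}_r(s)+\mathcal{O}\big((s-s_0)^{r+1}\big).$$
   Context: Full order model. Given $\bm{M},\bm{D},\bm{K}\in\mathbb{R}^{n\times n}$, $\bm{B}\in\mathbb{R}^{n\times p_i}$, $\bm{C}\in\mathbb{R}^{p_o\times n}$ and $s_0=ik_0$, set $\tilde{\bm{K}}=s_0^2\bm{M}+s_0\bm{D}+\bm{K}$ and $\tilde{\bm{D}}=2s_0\bm{M}+\bm{D}$. The transfer function is $$\bm{G}(s)=\bm{C}\,[(s-s_0)^2\bm{M}+(s-s_0)\tilde{\bm{D}}+\tilde{\bm{K}}]^{-1}\bm{B}.$$ Second order Krylov subspaces. For $\bm{A}_1,\bm{A}_2\in\mathbb{C}^{n\times n}$ and $\bm{P}_0\in\mathbb{C}^{n\times m}$, put $\bm{P}_1=\bm{A}_1\bm{P}_0$ and $\bm{P}_j=\bm{A}_1\bm{P}_{j-1}+\bm{A}_2\bm{P}_{j-2}$ for $j\ge2$, and let $\mathcal{K}_r(\bm{A}_1,\bm{A}_2,\bm{P}_0)\subset\mathbb{C}^n$ be the span of all columns of $\bm{P}_0,\dots,\bm{P}_{r-1}$. The input Krylov subspace about $s_0$ is $\mathcal{K}_r(-\tilde{\bm{K}}^{-1}\tilde{\bm{D}},-\tilde{\bm{K}}^{-1}\bm{M},-\tilde{\bm{K}}^{-1}\bm{B})$, and the output Krylov subspace is $\mathcal{K}_r(-\tilde{\bm{K}}^{-T}\tilde{\bm{D}}^T,-\tilde{\bm{K}}^{-T}\bm{M}^T,-\tilde{\bm{K}}^{-T}\bm{C}^T)$.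 Reduced order model. After $r$ iterations, a Krylov subspace-based method uses matrices $\bm{V},\bm{W}$ with the same number of columns, where either (one-sided) $\bm{W}=\bm{V}$ and the columns of $\bm{V}$ form an orthonormal basis of the input Krylov subspace (or of the output Krylov subspace), or (two-sided) the columns of $\bm{V}$ form an orthonormal basis of the input Krylov subspace and those of $\bm{W}$ an orthonormal basis of the output Krylov subspace, all built with index $r$. The same type of method is used for $r$ and $r+1$. For a single input and single output, generically $\bm{V}$ has $r$ columns, so the model has order $r$. Set $\{\bm{M}_r,\bm{D}_r,\bm{K}_r\}=\bm{W}^T\{\bm{M},\bm{D},\bm{K}\}\bm{V}$, $\bm{B}_r=\bm{W}^T\bm{B}$, $\bm{C}_r=\bm{C}\bm{V}$, $\tilde{\bm{K}}_r=s_0^2\bm{M}_r+s_0\bm{D}_r+\bm{K}_r$, $\tilde{\bm{D}}_r=2s_0\bm{M}_r+\bm{D}_r$. The reduced transfer function is $$\bm{G}_r(s)=\bm{C}_r\,[(s-s_0)^2\bm{M}_r+(s-s_0)\tilde{\bm{D}}_r+\tilde{\bm{K}}_r]^{-1}\bm{B}_r.$$ Here $f(s)=g(s)+\mathcal{O}((s-s_0)^{r+1})$ means that there are constants $c,\delta>0$ (possibly depending on $r$ and the system) with $|f(s)-g(s)|\le c|s-s_0|^{r+1}$ for $|s-s_0|<\delta$. *)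

theory Defs
  imports "HOL-Analysis.Analysis"
begin

definition cmatrix :: "real^'b^'a \<Rightarrow> complex^'b^'a" where
  "cmatrix A = map_matrix complex_of_real A"

definition cscale :: "complex \<Rightarrow> complex^'b^'a \<Rightarrow> complex^'b^'a" where
  "cscale c A = map_matrix ((*) c) A"

definition matrix_norm :: "(complex^'b^'a \<Rightarrow> real) \<Rightarrow> bool" where
  "matrix_norm N \<longleftrightarrow>
     (\<forall>A. 0 \<le> N A) \<and> (\<forall>A. N A = 0 \<longleftrightarrow> A = 0) \<and>
     (\<forall>c A. N (cscale c A) = cmod c * N A) \<and>
     (\<forall>A B. N (A + B) \<le> N A + N B)"

text \<open>
  The square matrices are complex so that the same definitions serve the full order model
  (via \<^const>\<open>cmatrix\<close>) and the reduced order models, whose matrices are complex.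
\<close>

definition K_tilde ::
  "complex \<Rightarrow> complex^'n^'n \<Rightarrow> complex^'n^'n \<Rightarrow> complex^'n^'n \<Rightarrow> complex^'n^'n" where
  "K_tilde s0 M D K = cscale (s0^2) M + cscale s0 D + K"

definition D_tilde :: "complex \<Rightarrow> complex^'n^'n \<Rightarrow> complex^'n^'n \<Rightarrow> complex^'n^'n" where
  "D_tilde s0 M D = cscale (2 * s0) M + D"

definition shifted_pencil ::
  "complex \<Rightarrow> complex^'n^'n \<Rightarrow> complex^'n^'n \<Rightarrow> complex^'n^'n \<Rightarrow> complex \<Rightarrow> complex^'n^'n" where
  "shifted_pencil s0 M D K s =
     cscale ((s - s0)^2) M + cscale (s - s0) (D_tilde s0 M D) + K_tilde s0 M D K"

text \<open>
  The value is meaningful only where the pencil is invertible, since \<^const>\<open>matrix_inv\<close> is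
  unspecified on singular matrices.
\<close>

definition transfer_function ::
  "complex \<Rightarrow> complex^'n^'n \<Rightarrow> complex^'n^'n \<Rightarrow> complex^'n^'n \<Rightarrow> complex^'i^'n \<Rightarrow> complex^'n^'o
     \<Rightarrow> complex \<Rightarrow> complex^'i^'o" where
  "transfer_function s0 M D K B C s = C ** matrix_inv (shifted_pencil s0 M D K s) ** B"

fun krylov_block ::
  "complex^'n^'n \<Rightarrow> complex^'n^'n \<Rightarrow> complex^'m^'n \<Rightarrow> nat \<Rightarrow> complex^'m^'n" where
  "krylov_block A1 A2 P0 0 = P0"
| "krylov_block A1 A2 P0 (Suc 0) = A1 ** P0"
| "krylov_block A1 A2 P0 (Suc (Suc j)) =
     A1 ** krylov_block A1 A2 P0 (Suc j) + A2 ** krylov_block A1 A2 P0 j"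

text \<open>
  \<^term>\<open>vec.span\<close> is the span over the complex numbers, in contrast to the real span
  \<^term>\<open>span\<close>.
\<close>

definition krylov_subspace ::
  "nat \<Rightarrow> complex^'n^'n \<Rightarrow> complex^'n^'n \<Rightarrow> complex^'m^'n \<Rightarrow> (complex^'n) set" where
  "krylov_subspace r A1 A2 P0 = vec.span (\<Union>j<r. columns (krylov_block A1 A2 P0 j))"

definition input_krylov ::
  "nat \<Rightarrow> complex \<Rightarrow> complex^'n^'n \<Rightarrow> complex^'n^'n \<Rightarrow> complex^'n^'n \<Rightarrow> complex^'i^'n
     \<Rightarrow> (complex^'n) set" where
  "input_krylov r s0 M D K B =
     (let Kinv = matrix_inv (K_tilde s0 M D K)
      in krylov_subspace r (- (Kinv ** D_tilde s0 M D)) (- (Kinv ** M)) (- (Kinv ** B)))"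

definition output_krylov ::
  "nat \<Rightarrow> complex \<Rightarrow> complex^'n^'n \<Rightarrow> complex^'n^'n \<Rightarrow> complex^'n^'n \<Rightarrow> complex^'n^'o
     \<Rightarrow> (complex^'n) set" where
  "output_krylov r s0 M D K C =
     (let KinvT = transpose (matrix_inv (K_tilde s0 M D K))
      in krylov_subspace r (- (KinvT ** transpose (D_tilde s0 M D)))
           (- (KinvT ** transpose M)) (- (KinvT ** transpose C)))"

text \<open>
  Orthonormality is with respect to the Hermitian inner product; the library's \<^const>\<open>inner\<close> on
  complex vectors is only its real part.
\<close>

definition hermitian_inner :: "complex^'n \<Rightarrow> complex^'n \<Rightarrow> complex" where
  "hermitian_inner x y = (\<Sum>i\<in>UNIV. cnj (x $ i) * y $ i)"

definition columns_orthonormal_basis :: "complex^'q^'n \<Rightarrow> (complex^'n) set \<Rightarrow> bool" where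
  "columns_orthonormal_basis V S \<longleftrightarrow>
     (\<forall>i j. hermitian_inner (column i V) (column j V) = (if i = j then 1 else 0)) \<and>
     vec.span (columns V) = S"

datatype krylov_method = One_Sided_Input | One_Sided_Output | Two_Sided

fun krylov_projection ::
  "krylov_method \<Rightarrow> nat \<Rightarrow> complex \<Rightarrow> complex^'n^'n \<Rightarrow> complex^'n^'n \<Rightarrow> complex^'n^'n
     \<Rightarrow> complex^'i^'n \<Rightarrow> complex^'n^'o \<Rightarrow> complex^'q^'n \<Rightarrow> complex^'q^'n \<Rightarrow> bool" where
  "krylov_projection One_Sided_Input r s0 M D K B C V W \<longleftrightarrow>
     W = V \<and> columns_orthonormal_basis V (input_krylov r s0 M D K B)"
| "krylov_projection One_Sided_Output r s0 M D K B C V W \<longleftrightarrow>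
     W = V \<and> columns_orthonormal_basis V (output_krylov r s0 M D K C)"
| "krylov_projection Two_Sided r s0 M D K B C V W \<longleftrightarrow>
     columns_orthonormal_basis V (input_krylov r s0 M D K B) \<and>
     columns_orthonormal_basis W (output_krylov r s0 M D K C)"

text \<open>The projection uses the plain transpose of \<open>W\<close>, not the conjugate transpose.\<close>

definition project :: "complex^'q^'n \<Rightarrow> complex^'q^'n \<Rightarrow> complex^'n^'n \<Rightarrow> complex^'q^'q" where
  "project V W A = transpose W ** A ** V"

definition reduced_pencil ::
  "complex^'q^'n \<Rightarrow> complex^'q^'n \<Rightarrow> complex \<Rightarrow> complex^'n^'n \<Rightarrow> complex^'n^'n \<Rightarrow> complex^'n^'n
     \<Rightarrow> complex \<Rightarrow> complex^'q^'q" where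
  "reduced_pencil V W s0 M D K =
     shifted_pencil s0 (project V W M) (project V W D) (project V W K)"

definition reduced_transfer_function ::
  "complex^'q^'n \<Rightarrow> complex^'q^'n \<Rightarrow> complex \<Rightarrow> complex^'n^'n \<Rightarrow> complex^'n^'n \<Rightarrow> complex^'n^'n
     \<Rightarrow> complex^'i^'n \<Rightarrow> complex^'n^'o \<Rightarrow> complex \<Rightarrow> complex^'i^'o" where
  "reduced_transfer_function V W s0 M D K B C =
     transfer_function s0 (project V W M) (project V W D) (project V W K)
       (transpose W ** B) (C ** V)"

definition equal_up_to_order :: "nat \<Rightarrow> complex \<Rightarrow> (complex \<Rightarrow> real) \<Rightarrow> (complex \<Rightarrow> real) \<Rightarrow> bool" where
  "equal_up_to_order k s0 f g \<longleftrightarrow>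
     (\<exists>c>0. \<exists>\<delta>>0. \<forall>s. cmod (s - s0) < \<delta> \<longrightarrow> \<bar>f s - g s\<bar> \<le> c * cmod (s - s0) ^ k)"

end

theory Submission
  imports Defs
begin

text \<open>
  Write \<open>h = s - s0\<close> and let \<open>P\<^sub>j\<close> be the Krylov blocks. The recursion makes the truncated series
  \<open>X = - (P\<^sub>0 + h P\<^sub>1 + \<dots> + h^(q-1) P\<^sub>q\<^sub>-\<^sub>1)\<close> solve the shifted system with right-hand side \<open>B\<close> up to a
  residual of order \<open>h^q\<close>. The columns of \<open>X\<close> lie in the range of \<open>V\<close>, so \<open>X\<close> solves the projected
  system up to the projected residual, and both transfer functions differ from \<open>C X\<close> by \<open>O(h^q)\<close>
  because the inverse pencils stay bounded near \<open>s0\<close>. Output Krylov subspaces are handled by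
  transposing the system. Replacing \<open>G\<close> by the model of index \<open>r + 1\<close> therefore changes
  the numerator of the relative error by \<open>O(h^(r+1))\<close>, while exchanging the denominators changes it by
  \<open>O(h^r) O(h^r)\<close>, and \<open>2 r \<ge> r + 1\<close>.
\<close>

section \<open>Matrix algebra\<close>

lemma cscale_nth [simp]: "cscale c A $ i $ j = c * A $ i $ j"
  by (simp add: cscale_def)

lemma matrix_add_rdistrib: "(A + A') ** X = A ** X + A' ** X" for A :: "'a::semiring_1^'n^'m"
  by (simp add: vec_eq_iff matrix_matrix_mult_def sum.distrib distrib_right)

lemma matrix_mul_cscale_left: "cscale c A ** X = cscale c (A ** X)"
  by (simp add: vec_eq_iff matrix_matrix_mult_def sum_distrib_left mult_ac)

lemma matrix_mul_cscale_right: "A ** cscale c X = cscale c (A ** X)"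
  by (simp add: vec_eq_iff matrix_matrix_mult_def sum_distrib_left mult_ac)

lemma transpose_nth: "transpose A $ i $ j = A $ j $ i"
  by (simp add: transpose_def)

lemma transpose_cscale: "transpose (cscale c A) = cscale c (transpose A)"
  by (simp add: vec_eq_iff transpose_nth)

lemma transpose_add: "transpose (A + X) = transpose A + transpose X"
  by (simp add: vec_eq_iff transpose_nth)

lemma matrix_mul_uminus_left: "(- A) ** X = - (A ** X)" for A :: "'a::ring_1^'n^'m"
  by (simp add: vec_eq_iff matrix_matrix_mult_def sum_negf)

lemma matrix_mul_uminus_right: "A ** (- X) = - (A ** X)" for A :: "'a::ring_1^'n^'m"
  by (simp add: vec_eq_iff matrix_matrix_mult_def sum_negf)

lemma matrix_mul_diff_left: "(A - A') ** X = A ** X - A' ** X" for A :: "'a::ring_1^'n^'m"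
  by (simp add: vec_eq_iff matrix_matrix_mult_def sum_subtractf algebra_simps)

lemma matrix_mul_diff_right: "A ** (X - X') = A ** X - A ** X'" for A :: "'a::ring_1^'n^'m"
  by (simp add: vec_eq_iff matrix_matrix_mult_def sum_subtractf algebra_simps)

lemma matrix_vector_mult_column: "A *v column l X = column l (A ** X)"
  by (simp add: vec_eq_iff matrix_vector_mult_def matrix_matrix_mult_def column_def)

lemma matrix_vector_mult_axis: "A *v axis i 1 = column i A" for A :: "'a::semiring_1^'n^'m"
  by (simp add: vec_eq_iff matrix_vector_mult_def column_def axis_def if_distrib cong: if_cong)

lemma
  assumes "invertible A"
  shows matrix_inv_right: "A ** matrix_inv A = mat 1"
    and matrix_inv_left: "matrix_inv A ** A = mat 1"
proof -
  have "A ** matrix_inv A = mat 1 \<and> matrix_inv A ** A = mat 1"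
    unfolding matrix_inv_def by (rule someI_ex) (use assms in \<open>simp add: invertible_def\<close>)
  then show "A ** matrix_inv A = mat 1" "matrix_inv A ** A = mat 1"
    by auto
qed

lemma matrix_inv_unique:
  assumes "invertible A" "A ** X = mat 1"
  shows "X = matrix_inv A"
  by (metis assms matrix_inv_left matrix_mul_assoc matrix_mul_lid matrix_mul_rid)

lemma matrix_inv_transpose:
  fixes A :: "'a::comm_semiring_1^'n^'m"
  assumes "invertible A"
  shows "invertible (transpose A)"
    and "matrix_inv (transpose A) = transpose (matrix_inv A)"
proof -
  have *: "transpose A ** transpose (matrix_inv A) = mat 1"
    "transpose (matrix_inv A) ** transpose A = mat 1"
    by (simp_all flip: matrix_transpose_mul add: matrix_inv_left matrix_inv_right assms)
  then show "invertible (transpose A)"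
    unfolding invertible_def by blast
  with * show "matrix_inv (transpose A) = transpose (matrix_inv A)"
    by (metis matrix_inv_unique)
qed

text \<open>The vectors \<open>V *v y\<close> contain the columns of \<open>V\<close> and are closed
  under linear combinations, so each column of \<open>X\<close> has a coefficient vector; these
  vectors are the columns of \<open>Y\<close>. This turns membership in a Krylov subspace into a
  factorization.\<close>

lemma matrix_eq_mult_if_columns_in_span:
  fixes X :: "'a::field^'m^'n" and V :: "'a^'q^'n"
  assumes "\<And>i. column i X \<in> vec.span (columns V)"
  obtains Y where "X = V ** Y"
proof -
  have "\<exists>y. V *v y = x" if "x \<in> vec.span (columns V)" for x
    using that
  proof (induction rule: vec.span_induct_alt)
    case base
    then show ?case by (metis matrix_vector_mult_0_right)
  next
    case (step c x z)
    then obtain i y where "x = column i V" "V *v y = z"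
      by (auto simp: columns_def)
    then have "V *v (c *s axis i 1 + y) = c *s x + z"
      by (simp add: vec.add vec.scale matrix_vector_mult_axis)
    then show ?case by blast
  qed
  with assms have "\<forall>i. \<exists>y. V *v y = column i X"
    by blast
  then obtain y where "\<And>i. V *v y i = column i X"
    by metis
  then have "X = V ** (\<chi> k i. y i $ k)"
    by (simp add: vec_eq_iff matrix_matrix_mult_def matrix_vector_mult_def column_def)
  then show thesis by (rule that)
qed

section \<open>Matrix-valued limits and growth\<close>

lemma tendsto_matrix_mult:
  fixes X :: "'s \<Rightarrow> complex^'b^'a" and Y :: "'s \<Rightarrow> complex^'c^'b"
  assumes "(X \<longlongrightarrow> L) F" "(Y \<longlongrightarrow> L') F"
  shows "((\<lambda>s. X s ** Y s) \<longlongrightarrow> L ** L') F"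
  by (intro vec_tendstoI)
     (auto simp: matrix_matrix_mult_def intro!: tendsto_intros assms)

section \<open>Continuity of the determinant and of the matrix inverse\<close>

lemma tendsto_det:
  fixes X :: "'s \<Rightarrow> complex^'n^'n"
  assumes "(X \<longlongrightarrow> L) F"
  shows "((\<lambda>s. det (X s)) \<longlongrightarrow> det L) F"
  unfolding det_def by (intro tendsto_intros assms)

lemma matrix_inv_cramer:
  fixes A :: "'a::field^'n^'n"
  assumes "invertible A"
  shows "matrix_inv A $ k $ l = det (\<chi> i j. if j = k then mat 1 $ i $ l else A $ i $ j) / det A"
proof -
  have "A *v column l (matrix_inv A) = column l (mat 1)"
    by (simp add: matrix_vector_mult_column matrix_inv_right assms)
  then have "column l (matrix_inv A)
      = (\<chi> k. det (\<chi> i j. if j = k then column l (mat 1) $ i else A $ i $ j) / det A)"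
    using assms by (subst (asm) cramer) (simp_all add: invertible_det_nz)
  from arg_cong[OF this, where f = "\<lambda>x. x $ k"] show ?thesis
    by (simp add: column_def cong: if_cong)
qed

text \<open>By Cramer's rule each entry of the inverse is a quotient of two determinants, both
  continuous in the entries, and the limit \<open>det L\<close> of the denominator is
  nonzero.\<close>

lemma tendsto_matrix_inv:
  fixes X :: "'s \<Rightarrow> complex^'n^'n"
  assumes X: "(X \<longlongrightarrow> L) F" and L: "invertible L" and inv: "\<forall>\<^sub>F s in F. invertible (X s)"
  shows "((\<lambda>s. matrix_inv (X s)) \<longlongrightarrow> matrix_inv L) F"
proof (intro vec_tendstoI)
  fix k l
  have "((\<lambda>s. if j = k then mat 1 $ i $ l else X s $ i $ j)
      \<longlongrightarrow> (if j = k then mat 1 $ i $ l else L $ i $ j)) F" for i j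
    by (auto intro!: tendsto_intros X)
  then have "((\<lambda>s. \<chi> i j. if j = k then mat 1 $ i $ l else X s $ i $ j)
      \<longlongrightarrow> (\<chi> i j. if j = k then mat 1 $ i $ l else L $ i $ j)) F"
    by (intro vec_tendstoI) simp
  then have "((\<lambda>s. det (\<chi> i j. if j = k then mat 1 $ i $ l else X s $ i $ j) / det (X s))
      \<longlongrightarrow> matrix_inv L $ k $ l) F"
    unfolding matrix_inv_cramer[OF L]
    using L by (intro tendsto_divide tendsto_det X) (simp_all add: invertible_det_nz)
  then show "((\<lambda>s. matrix_inv (X s) $ k $ l) \<longlongrightarrow> matrix_inv L $ k $ l) F"
    by (rule Lim_transform_eventually)
       (use inv in eventually_elim, simp add: matrix_inv_cramer)
qed

text \<open>Growth is measured entry by entry so that the Landau calculus for scalar functions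
  applies; \<open>matrix_norm_bigo\<close> passes from there to an arbitrary norm.\<close>

definition entrywise_bigo ::
  "'s filter \<Rightarrow> ('s \<Rightarrow> complex^'b^'a) \<Rightarrow> ('s \<Rightarrow> complex) \<Rightarrow> bool" where
  "entrywise_bigo F X g \<longleftrightarrow> (\<forall>i j. (\<lambda>s. X s $ i $ j) \<in> O[F](g))"

lemma entrywise_bigo_mult:
  assumes "entrywise_bigo F X f" "entrywise_bigo F Y g"
  shows "entrywise_bigo F (\<lambda>s. X s ** Y s) (\<lambda>s. f s * g s)"
  using assms unfolding entrywise_bigo_def matrix_matrix_mult_def
  by (auto intro!: big_sum_in_bigo landau_o.big.mult)

lemma entrywise_bigo_cscale:
  assumes "entrywise_bigo F X g"
  shows "entrywise_bigo F (\<lambda>s. cscale (f s) (X s)) (\<lambda>s. f s * g s)"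
  using assms unfolding entrywise_bigo_def by (auto intro!: landau_o.big.mult)

lemma entrywise_bigo_transpose:
  "entrywise_bigo F (\<lambda>s. transpose (X s)) g \<longleftrightarrow> entrywise_bigo F X g"
  unfolding entrywise_bigo_def transpose_nth by blast

lemma entrywise_bigo_tendsto:
  assumes "(X \<longlongrightarrow> L) F"
  shows "entrywise_bigo F X (\<lambda>_. 1)"
  unfolding entrywise_bigo_def
  by (intro allI bigoI_tendsto[where c = "L $ _ $ _"]) (auto intro!: tendsto_intros assms)

lemma entrywise_bigo_cong:
  assumes "\<forall>\<^sub>F s in F. X s = Y s"
  shows "entrywise_bigo F X g \<longleftrightarrow> entrywise_bigo F Y g"
proof -
  have "(\<lambda>s. X s $ i $ j) \<in> O[F](g) \<longleftrightarrow> (\<lambda>s. Y s $ i $ j) \<in> O[F](g)" for i j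
    by (rule landau_o.big.in_cong) (use assms in eventually_elim, simp)
  then show ?thesis by (simp add: entrywise_bigo_def)
qed

section \<open>Norms of matrix-valued functions\<close>

text \<open>Expand \<open>A\<close> in the matrix units \<open>axis i (axis j 1)\<close> and use
  subadditivity and homogeneity. This is the half of norm equivalence that bounds an arbitrary norm
  by the entries.\<close>

lemma matrix_norm_le_sum:
  fixes N :: "complex^'b^'a \<Rightarrow> real"
  assumes "matrix_norm N"
  shows "N A \<le> (\<Sum>i\<in>UNIV. \<Sum>j\<in>UNIV. cmod (A $ i $ j) * N (axis i (axis j 1)))"
proof -
  have N: "N 0 = 0" "N (X + Y) \<le> N X + N Y" "N (cscale c X) = cmod c * N X" for X Y c
    using assms by (auto simp: matrix_norm_def)
  have N_sum: "N (sum f S) \<le> (\<Sum>x\<in>S. N (f x))" if "finite S" for f :: "'x \<Rightarrow> _" and S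
    using that
  proof (induction S rule: finite_induct)
    case (insert x S)
    then show ?case using N(2)[of "f x" "sum f S"] by simp
  qed (simp add: N)
  have "(\<Sum>j\<in>UNIV. A $ i $ j * axis i (axis j 1) $ k $ l) = (if i = k then A $ k $ l else 0)" for i k l
    by (cases "i = k") (simp_all add: axis_def if_distrib [of "(*) _"] cong: if_cong)
  then have "A = (\<Sum>i\<in>UNIV. \<Sum>j\<in>UNIV. cscale (A $ i $ j) (axis i (axis j 1)))"
    by (simp add: vec_eq_iff)
  then have "N A = N (\<Sum>i\<in>UNIV. \<Sum>j\<in>UNIV. cscale (A $ i $ j) (axis i (axis j 1)))"
    by simp
  also have "\<dots> \<le> (\<Sum>i\<in>UNIV. \<Sum>j\<in>UNIV. N (cscale (A $ i $ j) (axis i (axis j 1))))"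
    by (intro order_trans[OF N_sum] sum_mono N_sum) simp_all
  finally show ?thesis by (simp add: N)
qed

lemma matrix_norm_bigo:
  assumes N: "matrix_norm N" and X: "entrywise_bigo F X g"
  shows "(\<lambda>s. N (X s)) \<in> O[F](\<lambda>s. cmod (g s))"
proof -
  have "(\<lambda>s. N (X s))
      \<in> O[F](\<lambda>s. \<Sum>i\<in>UNIV. \<Sum>j\<in>UNIV. cmod (X s $ i $ j) * N (axis i (axis j 1)))"
    using N matrix_norm_le_sum[OF N]
    by (intro landau_o.big_mono always_eventually allI)
       (auto simp: matrix_norm_def intro: order_trans[OF _ abs_ge_self])
  also have "\<dots> \<subseteq> O[F](\<lambda>s. cmod (g s))"
    using X unfolding entrywise_bigo_def
    by (intro landau_o.big.subsetI big_sum_in_bigo landau_o.big.mult_in_1 landau_o.big.norm_iff[THEN iffD2])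
       auto
  finally show ?thesis .
qed

lemma matrix_norm_minus_commute:
  assumes "matrix_norm N"
  shows "N (X - Y) = N (Y - X)"
proof -
  have "N (cscale (- 1) (Y - X)) = N (Y - X)"
    using assms by (simp add: matrix_norm_def)
  moreover have "cscale (- 1) (Y - X) = X - Y"
    by (simp add: vec_eq_iff)
  ultimately show ?thesis by simp
qed

lemma matrix_norm_reverse_triangle:
  assumes "matrix_norm N"
  shows "\<bar>N X - N Y\<bar> \<le> N (X - Y)"
proof -
  have "N (X - Y + Y) \<le> N (X - Y) + N Y" for X Y
    using assms unfolding matrix_norm_def by blast
  from this[of X Y] this[of Y X] show ?thesis
    by (simp add: matrix_norm_minus_commute[OF assms, of Y X])
qed

text \<open>The reverse triangle inequality bounds the change of \<open>N\<close> by
  \<open>N (X s - L)\<close>, which the expansion in matrix units bounds by entrywise differences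
  tending to 0.\<close>

lemma tendsto_matrix_norm:
  fixes X :: "'s \<Rightarrow> complex^'b^'a"
  assumes N: "matrix_norm N" and X: "(X \<longlongrightarrow> L) F"
  shows "((\<lambda>s. N (X s)) \<longlongrightarrow> N L) F"
proof -
  have "\<bar>N (X s) - N L\<bar>
      \<le> (\<Sum>i\<in>UNIV. \<Sum>j\<in>UNIV. cmod (X s $ i $ j - L $ i $ j) * N (axis i (axis j 1)))" for s
    using matrix_norm_reverse_triangle[OF N, of "X s" L] matrix_norm_le_sum[OF N, of "X s - L"]
    unfolding vector_minus_component by (rule order_trans)
  then have "\<forall>\<^sub>F s in F. norm (N (X s) - N L)
      \<le> (\<Sum>i\<in>UNIV. \<Sum>j\<in>UNIV. cmod (X s $ i $ j - L $ i $ j) * N (axis i (axis j 1)))"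
    unfolding real_norm_def by (intro always_eventually) simp
  moreover have "((\<lambda>s. \<Sum>i\<in>UNIV. \<Sum>j\<in>UNIV.
      cmod (X s $ i $ j - L $ i $ j) * N (axis i (axis j 1))) \<longlongrightarrow>
      (\<Sum>i\<in>UNIV. \<Sum>j\<in>UNIV. cmod (L $ i $ j - L $ i $ j) * N (axis i (axis j 1)))) F"
    by (intro tendsto_sum tendsto_mult tendsto_norm tendsto_diff tendsto_vec_nth tendsto_const X)
  ultimately have "((\<lambda>s. N (X s) - N L) \<longlongrightarrow> 0) F"
    by (elim Lim_null_comparison) simp
  then show ?thesis by (simp add: LIM_zero_iff)
qed

section \<open>Transfer functions\<close>

lemma tendsto_shifted_pencil:
  "(shifted_pencil s0 M D K \<longlongrightarrow> shifted_pencil s0 M D K s0) (nhds s0)"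
proof (intro vec_tendstoI)
  fix i j
  have "((\<lambda>s. (s - s0)^2 * M $ i $ j + (s - s0) * D_tilde s0 M D $ i $ j + K_tilde s0 M D K $ i $ j)
    \<longlongrightarrow> (s0 - s0)^2 * M $ i $ j + (s0 - s0) * D_tilde s0 M D $ i $ j + K_tilde s0 M D K $ i $ j)
    (nhds s0)"
    by (intro tendsto_intros filterlim_ident)
  then show "((\<lambda>s. shifted_pencil s0 M D K s $ i $ j)
      \<longlongrightarrow> shifted_pencil s0 M D K s0 $ i $ j) (nhds s0)"
    by (simp add: shifted_pencil_def)
qed

lemma tendsto_shifted_pencil_inv:
  assumes "\<forall>\<^sub>F s in nhds s0. invertible (shifted_pencil s0 M D K s)"
  shows "((\<lambda>s. matrix_inv (shifted_pencil s0 M D K s))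
    \<longlongrightarrow> matrix_inv (shifted_pencil s0 M D K s0)) (nhds s0)"
  \<comment> \<open>The filter \<open>nhds s0\<close> includes the point \<open>s0\<close> itself,
    so eventual invertibility also gives invertibility of the limit.\<close>
  using assms
  by (intro tendsto_matrix_inv tendsto_shifted_pencil) (auto dest: eventually_nhds_x_imp_x)

lemma tendsto_transfer_function:
  assumes "\<forall>\<^sub>F s in nhds s0. invertible (shifted_pencil s0 M D K s)"
  shows "(transfer_function s0 M D K B C \<longlongrightarrow> transfer_function s0 M D K B C s0) (nhds s0)"
  unfolding transfer_function_def
  by (intro tendsto_matrix_mult tendsto_const tendsto_shifted_pencil_inv assms)

text \<open>Projection is linear in the system matrices and so commutes with forming the pencil. The
  reduced model is thus a Petrov-Galerkin projection of the full system at every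
  \<open>s\<close>.\<close>

lemma reduced_pencil_eq:
  "reduced_pencil V W s0 M D K s = transpose W ** shifted_pencil s0 M D K s ** V"
  by (simp add: reduced_pencil_def shifted_pencil_def D_tilde_def K_tilde_def project_def
      matrix_add_ldistrib matrix_add_rdistrib matrix_mul_cscale_left matrix_mul_cscale_right)

lemma reduced_transfer_function_eq:
  "reduced_transfer_function V W s0 M D K B C s
    = C ** V ** matrix_inv (reduced_pencil V W s0 M D K s) ** transpose W ** B"
  by (simp add: reduced_transfer_function_def transfer_function_def reduced_pencil_def
      matrix_mul_assoc)

section \<open>Moment matching\<close>

text \<open>Multiplied by \<open>Kt\<close>, the recursion says
  \<open>Kt ** P (j+2) + D_tilde ** P (j+1) + M ** P j = 0\<close>. With \<open>h = s - s0\<close>,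
  the coefficients of \<open>h^1\<close> to \<open>h^q\<close> therefore cancel and the constant
  term is \<open>Kt ** P 0 = - B\<close>. Only the powers \<open>q + 1\<close> and
  \<open>q + 2\<close> survive the truncation.\<close>

lemma krylov_residual:
  fixes M D K :: "complex^'n^'n" and B :: "complex^'i^'n" and s0 :: complex
  defines "Kt \<equiv> K_tilde s0 M D K"
  defines "P \<equiv> krylov_block (- (matrix_inv Kt ** D_tilde s0 M D)) (- (matrix_inv Kt ** M))
      (- (matrix_inv Kt ** B))"
  assumes "invertible Kt"
  shows "shifted_pencil s0 M D K s ** (\<Sum>j<Suc q. cscale ((s - s0)^j) (P j))
    = - B - cscale ((s - s0)^Suc q) (Kt ** P (Suc q) - cscale (s - s0) (M ** P q))"
proof -
  have inv: "Kt ** (matrix_inv Kt ** X) = X" for X :: "complex^'i^'n"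
    using assms by (simp add: matrix_mul_assoc matrix_inv_right)
  have P_0: "Kt ** P 0 = - B"
    by (simp add: P_def matrix_mul_uminus_right inv)
  have P_1: "Kt ** P (Suc 0) = - (D_tilde s0 M D ** P 0)"
    by (simp add: P_def matrix_mul_uminus_left matrix_mul_uminus_right inv flip: matrix_mul_assoc)
  have P_Suc: "Kt ** P (Suc (Suc j)) = - (D_tilde s0 M D ** P (Suc j)) - M ** P j" for j
    by (simp add: P_def matrix_mul_uminus_left matrix_mul_uminus_right matrix_mul_diff_right inv
        flip: matrix_mul_assoc)
  have pencil: "shifted_pencil s0 M D K s ** X
      = cscale ((s - s0)^2) (M ** X) + cscale (s - s0) (D_tilde s0 M D ** X) + Kt ** X"
    for X :: "complex^'i^'n"
    by (simp add: shifted_pencil_def matrix_add_rdistrib matrix_mul_cscale_left Kt_def)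
  show ?thesis
  proof (induction q)
    case 0
    then show ?case
      by (simp add: pencil matrix_mul_cscale_right P_0 P_1 vec_eq_iff algebra_simps power2_eq_square)
  next
    case (Suc q)
    then show ?case
      \<comment> \<open>Only the newest summand is split off, keeping the sum of the induction
        hypothesis intact. Its \<open>Kt\<close> part cancels the old leading residual;
        \<open>P_Suc\<close> rewrites its \<open>D_tilde\<close> part together with the remaining
        \<open>M\<close> part as the new one.\<close>
      by (simp add: sum.lessThan_Suc[of _ "Suc q"] matrix_add_ldistrib pencil
          matrix_mul_cscale_right P_Suc vec_eq_iff algebra_simps power2_eq_square
          del: sum.lessThan_Suc)
  qed
qed

text \<open>Both the full solution and the lifted reduced solution equal \<open>V ** Y\<close> up to
  a term linear in the residual \<open>Z\<close>: multiply the equation for \<open>V ** Y\<close> by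
  the inverse of \<open>F\<close>, or first by \<open>transpose W\<close> and then by the inverse of
  the reduced matrix. In the difference \<open>V ** Y\<close> drops out.\<close>

lemma petrov_galerkin_error:
  fixes F :: "complex^'n^'n" and V W :: "complex^'q^'n"
  assumes F: "invertible F" and R: "invertible (transpose W ** F ** V)"
    and X: "F ** (V ** Y) = B + Z"
  shows "C ** matrix_inv F ** B - C ** V ** matrix_inv (transpose W ** F ** V) ** transpose W ** B
    = C ** (V ** matrix_inv (transpose W ** F ** V) ** transpose W - matrix_inv F) ** Z"
proof -
  define H where "H = transpose W ** F ** V"
  have "matrix_inv F ** (F ** (V ** Y)) = V ** Y"
    by (simp add: matrix_mul_assoc matrix_inv_left F)
  then have 1: "matrix_inv F ** B = V ** Y - matrix_inv F ** Z"
    by (simp add: X matrix_add_ldistrib algebra_simps)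
  have "H ** Y = transpose W ** (B + Z)"
    by (simp add: H_def flip: matrix_mul_assoc X)
  then have "matrix_inv H ** (transpose W ** (B + Z)) = Y"
    using R by (metis H_def matrix_inv_left matrix_mul_assoc matrix_mul_lid)
  then have 2: "matrix_inv H ** (transpose W ** B) = Y - matrix_inv H ** (transpose W ** Z)"
    by (simp add: matrix_add_ldistrib algebra_simps)
  show ?thesis
    unfolding H_def[symmetric]
    by (simp add: 1 2 matrix_mul_diff_left matrix_mul_diff_right flip: matrix_mul_assoc)
qed

text \<open>The truncated Krylov series lies in the range of \<open>V\<close> and has a residual of
  order \<open>Suc q\<close>, which the Petrov-Galerkin error formula carries over to the transfer
  functions. Since the Krylov condition concerns only \<open>V\<close>, the lemma covers one-sided
  and two-sided methods alike.\<close>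

lemma moment_matching_input:
  fixes M D K :: "complex^'n^'n" and B :: "complex^'i^'n" and C :: "complex^'n^'o"
    and V W :: "complex^'q^'n"
  assumes Kt: "invertible (K_tilde s0 M D K)"
    and V: "vec.span (columns V) = input_krylov (Suc q) s0 M D K B"
    and full: "\<forall>\<^sub>F s in nhds s0. invertible (shifted_pencil s0 M D K s)"
    and reduced: "\<forall>\<^sub>F s in nhds s0. invertible (reduced_pencil V W s0 M D K s)"
  shows "entrywise_bigo (nhds s0)
    (\<lambda>s. transfer_function s0 M D K B C s - reduced_transfer_function V W s0 M D K B C s)
    (\<lambda>s. (s - s0)^Suc q)"
proof -
  define Kinv where "Kinv = matrix_inv (K_tilde s0 M D K)"
  define P where "P = krylov_block (- (Kinv ** D_tilde s0 M D)) (- (Kinv ** M)) (- (Kinv ** B))"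
  \<comment> \<open>The sign compensates for the starting block \<open>- (Kinv ** B)\<close>, so
    that \<open>X\<close> approximates the solution for \<open>B\<close> rather than
    \<open>- B\<close>.\<close>
  define X where "X = (\<lambda>s. - (\<Sum>j<Suc q. cscale ((s - s0)^j) (P j)))"
  define R where "R = (\<lambda>s. K_tilde s0 M D K ** P (Suc q) - cscale (s - s0) (M ** P q))"
  define F where "F = shifted_pencil s0 M D K"
  define H where "H = reduced_pencil V W s0 M D K"
  define T where "T = (\<lambda>s. C ** (V ** matrix_inv (H s) ** transpose W - matrix_inv (F s)))"
  have X: "F s ** X s = B + cscale ((s - s0)^Suc q) (R s)" for s
    using krylov_residual[OF Kt, where q = q and B = B and s = s]
    by (simp add: F_def X_def R_def P_def Kinv_def matrix_mul_uminus_right del: sum.lessThan_Suc)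
  have column_P: "column i (P j) \<in> vec.span (columns V)" if "j < Suc q" for i j
    unfolding V input_krylov_def krylov_subspace_def Let_def
    using that by (intro vec.span_base) (auto simp: P_def Kinv_def columns_def)
  have "column i (X s)
      = - (\<Sum>j<Suc q. (s - s0)^j *s column i (P j))" for i s
    by (simp add: X_def vec_eq_iff column_def del: sum.lessThan_Suc)
  then have "column i (X s) \<in> vec.span (columns V)" for i s
    using column_P by (auto intro!: vec.span_neg vec.span_sum vec.span_scale simp del: sum.lessThan_Suc)
  then have range: "\<exists>Y. X s = V ** Y" for s
    by (metis matrix_eq_mult_if_columns_in_span)
  have "\<forall>\<^sub>F s in nhds s0.
      transfer_function s0 M D K B C s - reduced_transfer_function V W s0 M D K B C s
      = cscale ((s - s0)^Suc q) (T s ** R s)"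
    using full reduced
  proof eventually_elim
    case (elim s)
    obtain Y where "X s = V ** Y" using range by blast
    with elim X[of s] show ?case
      unfolding transfer_function_def reduced_transfer_function_eq T_def H_def F_def reduced_pencil_eq
      by (subst petrov_galerkin_error) (auto simp: matrix_mul_cscale_right)
  qed
  \<comment> \<open>Both \<open>T\<close> and \<open>R\<close> converge at \<open>s0\<close> and
    contribute only bounded factors.\<close>
  moreover have "entrywise_bigo (nhds s0) (\<lambda>s. cscale ((s - s0)^Suc q) (T s ** R s))
      (\<lambda>s. (s - s0)^Suc q * (1 * 1))"
  proof (intro entrywise_bigo_cscale entrywise_bigo_mult)
    show "entrywise_bigo (nhds s0) T (\<lambda>_. 1)"
      unfolding T_def F_def H_def reduced_pencil_def
      by (rule entrywise_bigo_tendsto tendsto_matrix_mult tendsto_const tendsto_diff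
          tendsto_shifted_pencil_inv full reduced [unfolded reduced_pencil_def])+
    have "(R \<longlongrightarrow> K_tilde s0 M D K ** P (Suc q) - cscale (s0 - s0) (M ** P q)) (nhds s0)"
      unfolding R_def
      by (intro vec_tendstoI) (auto intro!: tendsto_eq_intros filterlim_ident)
    then show "entrywise_bigo (nhds s0) R (\<lambda>_. 1)"
      by (rule entrywise_bigo_tendsto)
  qed
  ultimately show ?thesis
    by (simp add: entrywise_bigo_cong)
qed

section \<open>Duality: transposing the system exchanges inputs and outputs\<close>

lemma transpose_shifted_pencil:
  "shifted_pencil s0 (transpose M) (transpose D) (transpose K) s
    = transpose (shifted_pencil s0 M D K s)"
  by (simp add: shifted_pencil_def D_tilde_def K_tilde_def transpose_add transpose_cscale)

text \<open>Invertibility is what lets \<open>matrix_inv\<close> commute with transposition, its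
  value on singular matrices being unspecified.\<close>

lemma transpose_transfer_function:
  assumes "invertible (shifted_pencil s0 M D K s)"
  shows "transfer_function s0 (transpose M) (transpose D) (transpose K) (transpose C) (transpose B) s
    = transpose (transfer_function s0 M D K B C s)"
  unfolding transfer_function_def transpose_shifted_pencil matrix_inv_transpose(2)[OF assms]
      matrix_transpose_mul matrix_mul_assoc ..

lemma transpose_project: "project W V (transpose A) = transpose (project V W A)"
  by (simp add: project_def matrix_transpose_mul matrix_mul_assoc)

lemma transpose_reduced_transfer_function:
  assumes "invertible (reduced_pencil V W s0 M D K s)"
  shows "reduced_transfer_function W V s0 (transpose M) (transpose D) (transpose K)
      (transpose C) (transpose B) s
    = transpose (reduced_transfer_function V W s0 M D K B C s)"
  using transpose_transfer_function[OF assms[unfolded reduced_pencil_def],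
      where B = "transpose W ** B" and C = "C ** V"]
  by (simp add: reduced_transfer_function_def transpose_project matrix_transpose_mul)

lemma output_krylov_eq:
  assumes "invertible (K_tilde s0 M D K)"
  shows "output_krylov r s0 M D K C
    = input_krylov r s0 (transpose M) (transpose D) (transpose K) (transpose C)"
proof -
  have "K_tilde s0 (transpose M) (transpose D) (transpose K) = transpose (K_tilde s0 M D K)"
    "D_tilde s0 (transpose M) (transpose D) = transpose (D_tilde s0 M D)"
    by (simp_all add: D_tilde_def K_tilde_def transpose_add transpose_cscale)
  then show ?thesis
    by (simp add: output_krylov_def input_krylov_def matrix_inv_transpose[OF assms])
qed

text \<open>The output Krylov subspace is the input Krylov subspace of the transposed system, where
  \<open>V\<close> and \<open>W\<close> exchange roles. Transposing the resulting error back leaves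
  entrywise bounds unchanged.\<close>

lemma moment_matching_output:
  fixes M D K :: "complex^'n^'n" and B :: "complex^'i^'n" and C :: "complex^'n^'o"
    and V W :: "complex^'q^'n"
  assumes Kt: "invertible (K_tilde s0 M D K)"
    and W: "vec.span (columns W) = output_krylov (Suc q) s0 M D K C"
    and full: "\<forall>\<^sub>F s in nhds s0. invertible (shifted_pencil s0 M D K s)"
    and reduced: "\<forall>\<^sub>F s in nhds s0. invertible (reduced_pencil V W s0 M D K s)"
  shows "entrywise_bigo (nhds s0)
    (\<lambda>s. transfer_function s0 M D K B C s - reduced_transfer_function V W s0 M D K B C s)
    (\<lambda>s. (s - s0)^Suc q)"
proof -
  let ?G = "transfer_function s0 (transpose M) (transpose D) (transpose K) (transpose C) (transpose B)"
  let ?Gr = "reduced_transfer_function W V s0 (transpose M) (transpose D) (transpose K)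
      (transpose C) (transpose B)"
  have "K_tilde s0 (transpose M) (transpose D) (transpose K) = transpose (K_tilde s0 M D K)"
    by (simp add: K_tilde_def transpose_add transpose_cscale)
  moreover have "reduced_pencil W V s0 (transpose M) (transpose D) (transpose K) s
      = transpose (reduced_pencil V W s0 M D K s)" for s
    by (simp add: reduced_pencil_def transpose_project transpose_shifted_pencil)
  ultimately have "entrywise_bigo (nhds s0) (\<lambda>s. ?G s - ?Gr s) (\<lambda>s. (s - s0)^Suc q)"
    using full reduced Kt W
    by (intro moment_matching_input)
       (auto simp: output_krylov_eq transpose_shifted_pencil matrix_inv_transpose elim: eventually_mono)
  moreover have "\<forall>\<^sub>F s in nhds s0. ?G s - ?Gr s
      = transpose (transfer_function s0 M D K B C s - reduced_transfer_function V W s0 M D K B C s)"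
    using full reduced
    by eventually_elim
       (simp add: transpose_transfer_function transpose_reduced_transfer_function
         vec_eq_iff transpose_nth)
  ultimately show ?thesis
    by (simp add: entrywise_bigo_cong entrywise_bigo_transpose)
qed

lemma moment_matching:
  fixes M D K :: "complex^'n^'n" and B :: "complex^'i^'n" and C :: "complex^'n^'o"
    and V W :: "complex^'q^'n"
  assumes "invertible (K_tilde s0 M D K)" "r \<ge> 1"
    and "krylov_projection method_type r s0 M D K B C V W"
    and "\<forall>\<^sub>F s in nhds s0. invertible (shifted_pencil s0 M D K s)"
    and "\<forall>\<^sub>F s in nhds s0. invertible (reduced_pencil V W s0 M D K s)"
  shows "entrywise_bigo (nhds s0)
    (\<lambda>s. transfer_function s0 M D K B C s - reduced_transfer_function V W s0 M D K B C s)
    (\<lambda>s. (s - s0)^r)"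
proof -
  \<comment> \<open>The residual for index \<open>r\<close> involves the blocks with indices
    \<open>r\<close> and \<open>r - 1\<close>, hence the successor form.\<close>
  obtain q where "r = Suc q"
    using \<open>r \<ge> 1\<close> by (cases r) auto
  with assms show ?thesis
    using moment_matching_input[of s0 M D K V q B W C] moment_matching_output[of s0 M D K W q C V B]
    by (cases method_type) (auto simp: columns_orthonormal_basis_def)
qed

section \<open>Relative errors\<close>

text \<open>The bound in \<open>equal_up_to_order\<close> includes \<open>s = s0\<close>, which is
  why the Landau symbols are taken along \<open>nhds s0\<close> and not along the punctured
  filter.\<close>

lemma equal_up_to_orderI:
  assumes "(\<lambda>s. f s - g s) \<in> O[nhds s0](\<lambda>s. cmod (s - s0) ^ k)"
  shows "equal_up_to_order k s0 f g"
proof -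
  from assms obtain c where "c > 0" and
    "\<forall>\<^sub>F s in nhds s0. norm (f s - g s) \<le> c * norm (cmod (s - s0) ^ k)"
    by (elim landau_o.bigE)
  then show ?thesis
    unfolding equal_up_to_order_def eventually_nhds_metric by (auto simp: dist_norm)
qed

lemma cmod_power_bigo:
  assumes "m \<le> n"
  shows "(\<lambda>s. cmod (s - s0) ^ n) \<in> O[nhds s0](\<lambda>s. cmod (s - s0) ^ m)"
proof -
  have "((\<lambda>s. cmod (s - s0) ^ (n - m)) \<longlongrightarrow> cmod (s0 - s0) ^ (n - m)) (nhds s0)"
    by (intro tendsto_intros filterlim_ident)
  then have "(\<lambda>s. cmod (s - s0) ^ (n - m)) \<in> O[nhds s0](\<lambda>_. 1)"
    by (intro bigoI_tendsto[where c = "cmod (s0 - s0) ^ (n - m)"]) auto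
  then have "(\<lambda>s. cmod (s - s0) ^ m * cmod (s - s0) ^ (n - m))
      \<in> O[nhds s0](\<lambda>s. cmod (s - s0) ^ m * 1)"
    by (intro landau_o.big.mult) auto
  with assms show ?thesis by (simp flip: power_add)
qed

text \<open>\<open>H\<close> is the model in the denominator of the estimator. Keeping it separate
  from \<open>A\<close> and \<open>A'\<close> treats both estimators at once: \<open>H\<close> is
  later the model of index \<open>r\<close> or that of index \<open>r + 1\<close>.\<close>

lemma relative_error_estimator:
  fixes G A A' H :: "complex \<Rightarrow> complex^'i^'o"
  assumes N: "matrix_norm N" and r: "r \<ge> 1"
    and G: "(G \<longlongrightarrow> G0) (nhds s0)" "G0 \<noteq> 0" and H: "(H \<longlongrightarrow> H0) (nhds s0)" "H0 \<noteq> 0"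
    and GA: "entrywise_bigo (nhds s0) (\<lambda>s. G s - A s) (\<lambda>s. (s - s0)^r)"
    and GA': "entrywise_bigo (nhds s0) (\<lambda>s. G s - A' s) (\<lambda>s. (s - s0)^(r + 1))"
    and GH: "entrywise_bigo (nhds s0) (\<lambda>s. G s - H s) (\<lambda>s. (s - s0)^m)" "m \<ge> r"
  shows "equal_up_to_order (r + 1) s0
    (\<lambda>s. N (G s - A s) / N (G s)) (\<lambda>s. N (A' s - A s) / N (H s))"
proof (rule equal_up_to_orderI)
  define h where "h = (\<lambda>k s. cmod (s - s0) ^ k)"
  have h: "h n \<in> O[nhds s0](h k)" if "k \<le> n" for k n
    using cmod_power_bigo[OF that] by (simp add: h_def)
  have NG: "(\<lambda>s. N (G s - A s)) \<in> O[nhds s0](h r)"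
    "(\<lambda>s. N (G s - A' s)) \<in> O[nhds s0](h (r + 1))"
    "(\<lambda>s. N (G s - H s)) \<in> O[nhds s0](h m)"
    using matrix_norm_bigo[OF N GA] matrix_norm_bigo[OF N GA'] matrix_norm_bigo[OF N GH(1)]
    by (simp_all add: h_def norm_power norm_mult)
  \<comment> \<open>A nonzero limit keeps the reciprocal bounded and makes division legitimate near
    \<open>s0\<close>.\<close>
  have inverse: "(\<lambda>s. inverse (N (X s))) \<in> O[nhds s0](\<lambda>_. 1)" "\<forall>\<^sub>F s in nhds s0. N (X s) \<noteq> 0"
    if "(X \<longlongrightarrow> L) (nhds s0)" "L \<noteq> 0" for X L
  proof -
    have lim: "((\<lambda>s. N (X s)) \<longlongrightarrow> N L) (nhds s0)" and "N L \<noteq> 0"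
      using that N by (auto intro: tendsto_matrix_norm simp: matrix_norm_def)
    then have "((\<lambda>s. inverse (N (X s))) \<longlongrightarrow> inverse (N L)) (nhds s0)"
      by (intro tendsto_inverse)
    then show "(\<lambda>s. inverse (N (X s))) \<in> O[nhds s0](\<lambda>_. 1)"
      by (intro bigoI_tendsto[where c = "inverse (N L)"]) auto
    show "\<forall>\<^sub>F s in nhds s0. N (X s) \<noteq> 0"
      using lim \<open>N L \<noteq> 0\<close> by (rule tendsto_imp_eventually_ne)
  qed
  have minus: "N (X - Y) = N (Y - X)" for X Y
    by (rule matrix_norm_minus_commute[OF N])
  have diff: "\<bar>N X - N Y\<bar> \<le> N (X - Y)" for X Y
    by (rule matrix_norm_reverse_triangle[OF N])
  \<comment> \<open>\<open>A\<close> cancels in the difference of the arguments, leaving only the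
    error of the better model \<open>A'\<close>.\<close>
  have "\<bar>N (G s - A s) - N (A' s - A s)\<bar> \<le> \<bar>N (G s - A' s)\<bar>" for s
    using diff[of "G s - A s" "A' s - A s"] by simp
  then have num: "(\<lambda>s. N (G s - A s) - N (A' s - A s)) \<in> O[nhds s0](h (r + 1))"
    by (intro landau_o.big.trans[OF landau_o.big_mono NG(2)] always_eventually) simp
  have "\<bar>N (H s) - N (G s)\<bar> \<le> \<bar>N (G s - H s)\<bar>" for s
    using diff[of "H s" "G s"] by (simp add: minus)
  then have den: "(\<lambda>s. N (H s) - N (G s)) \<in> O[nhds s0](h r)"
    by (intro landau_o.big.trans[OF landau_o.big_mono landau_o.big.trans[OF NG(3) h[OF GH(2)]]]
        always_eventually) simp
  have est: "(\<lambda>s. N (A' s - A s)) \<in> O[nhds s0](h r)"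
  proof -
    have "(\<lambda>s. N (G s - A s) - (N (G s - A s) - N (A' s - A s))) \<in> O[nhds s0](h r)"
      using NG(1) landau_o.big.trans[OF num h[OF le_add1]] by (rule sum_in_bigo(2))
    then show ?thesis by simp
  qed
  \<comment> \<open>The splitting is \<open>a/x - b/y = (a - b)/x + b (y - x)/(x y)\<close>, with
    \<open>a\<close>, \<open>b\<close> the numerators and \<open>x\<close>, \<open>y\<close> the
    denominators of the true and the estimated error.\<close>
  have "(\<lambda>s. (N (G s - A s) - N (A' s - A s)) * inverse (N (G s))) \<in> O[nhds s0](\<lambda>s. h (r + 1) s * 1)"
    by (intro landau_o.big.mult num inverse(1)[OF G])
  moreover have "(\<lambda>s. N (A' s - A s) * (N (H s) - N (G s)) * inverse (N (G s)) * inverse (N (H s)))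
      \<in> O[nhds s0](h (r + 1))"
  proof (rule landau_o.big.trans)
    show "(\<lambda>s. N (A' s - A s) * (N (H s) - N (G s)) * inverse (N (G s)) * inverse (N (H s)))
        \<in> O[nhds s0](\<lambda>s. h r s * h r s * 1 * 1)"
      by (intro landau_o.big.mult est den inverse(1)[OF G] inverse(1)[OF H])
    show "(\<lambda>s. h r s * h r s * 1 * 1) \<in> O[nhds s0](h (r + 1))"
      using h[of "r + 1" "r + r"] r by (simp add: h_def power_add)
  qed
  ultimately have "(\<lambda>s. (N (G s - A s) - N (A' s - A s)) * inverse (N (G s))
      + N (A' s - A s) * (N (H s) - N (G s)) * inverse (N (G s)) * inverse (N (H s)))
      \<in> O[nhds s0](h (r + 1))"
    by (intro sum_in_bigo) simp_all
  moreover have "\<forall>\<^sub>F s in nhds s0. (N (G s - A s) - N (A' s - A s)) * inverse (N (G s))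
      + N (A' s - A s) * (N (H s) - N (G s)) * inverse (N (G s)) * inverse (N (H s))
      = N (G s - A s) / N (G s) - N (A' s - A s) / N (H s)"
    using inverse(2)[OF G] inverse(2)[OF H] by eventually_elim (simp add: field_simps)
  ultimately have "(\<lambda>s. N (G s - A s) / N (G s) - N (A' s - A s) / N (H s))
      \<in> O[nhds s0](h (r + 1))"
    by (simp add: landau_o.big.in_cong)
  then show "(\<lambda>s. N (G s - A s) / N (G s) - N (A' s - A s) / N (H s))
      \<in> O[nhds s0](\<lambda>s. cmod (s - s0) ^ (r + 1))"
    unfolding h_def .
qed

theorem theorem4p2:
  fixes M D K :: "complex^'n^'n"
    and B :: "complex^'i^'n"
    and C :: "complex^'n^'o"
    and Mreal Dreal Kreal :: "real^'n^'n"
    and Breal :: "real^'i^'n"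
    and Creal :: "real^'n^'o"
    and k0 :: real
    and s0 :: complex
    and r :: nat
    and method_type :: krylov_method
    and V W :: "complex^'q^'n"
    and V' W' :: "complex^'p^'n"
    and N :: "complex^'i^'o \<Rightarrow> real"
    and G Gr Gr1 :: "complex \<Rightarrow> complex^'i^'o"
    and E E_hat E_til :: "complex \<Rightarrow> real"
  assumes real_system: "M = cmatrix Mreal" "D = cmatrix Dreal" "K = cmatrix Kreal"
      "B = cmatrix Breal" "C = cmatrix Creal"
    and s0: "k0 > 0" "s0 = \<i> * complex_of_real k0"
    and K_tilde: "invertible (K_tilde s0 M D K)"
    and r: "r \<ge> 1"
    and VW: "krylov_projection method_type r s0 M D K B C V W"
    and VW': "krylov_projection method_type (r + 1) s0 M D K B C V' W'"
    and G: "G = transfer_function s0 M D K B C"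
    and Gr: "Gr = reduced_transfer_function V W s0 M D K B C"
    and Gr1: "Gr1 = reduced_transfer_function V' W' s0 M D K B C"
    and G_defined: "\<forall>\<^sub>F s in nhds s0. invertible (shifted_pencil s0 M D K s)"
    and Gr_defined: "\<forall>\<^sub>F s in nhds s0. invertible (reduced_pencil V W s0 M D K s)"
    and Gr1_defined: "\<forall>\<^sub>F s in nhds s0. invertible (reduced_pencil V' W' s0 M D K s)"
    and nonzero: "G s0 \<noteq> 0" "Gr s0 \<noteq> 0" "Gr1 s0 \<noteq> 0"
    and N: "matrix_norm N"
    and E: "E = (\<lambda>s. N (G s - Gr s) / N (G s))"
    and E_hat: "E_hat = (\<lambda>s. N (Gr1 s - Gr s) / N (Gr s))"
    and E_til: "E_til = (\<lambda>s. N (Gr1 s - Gr s) / N (Gr1 s))"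
  shows "equal_up_to_order (r + 1) s0 E E_hat \<and> equal_up_to_order (r + 1) s0 E E_til"
proof -
  note full = tendsto_transfer_function[OF G_defined, of B C, folded G]
  have Gr_lim: "(Gr \<longlongrightarrow> Gr s0) (nhds s0)"
    using Gr_defined unfolding Gr reduced_transfer_function_def reduced_pencil_def
    by (rule tendsto_transfer_function)
  have Gr1_lim: "(Gr1 \<longlongrightarrow> Gr1 s0) (nhds s0)"
    using Gr1_defined unfolding Gr1 reduced_transfer_function_def reduced_pencil_def
    by (rule tendsto_transfer_function)
  have err: "entrywise_bigo (nhds s0) (\<lambda>s. G s - Gr s) (\<lambda>s. (s - s0)^r)"
    using moment_matching[OF K_tilde r VW G_defined Gr_defined] by (simp add: G Gr)
  have err1: "entrywise_bigo (nhds s0) (\<lambda>s. G s - Gr1 s) (\<lambda>s. (s - s0)^(r + 1))"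
    using moment_matching[OF K_tilde _ VW' G_defined Gr1_defined] by (simp add: G Gr1)
  show ?thesis
    unfolding E E_hat E_til
    \<comment> \<open>The first instance takes \<open>H = Gr\<close> with \<open>m = r\<close>, the
      second \<open>H = Gr1\<close> with \<open>m = r + 1\<close>.\<close>
    using relative_error_estimator[OF N r full nonzero(1) Gr_lim nonzero(2) err err1 err]
      relative_error_estimator[OF N r full nonzero(1) Gr1_lim nonzero(3) err err1 err1]
    by simp
qed

end
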